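(* It is impossible to walk to infinity on primes in base $2$ by appending no more than $2$ digits at a time to the right. That is, there is no infinite sequence of primes $p_0, p_1, p_2, \ldots$ such that for every $i \ge 0$ the base-$2$ representation of $p_{i+1}$ is obtained from the base-$2$ representation of $p_i$ by appending one or two binary digits on the right (equivalently, $p_{i+1} = 2^{m} p_i + d$ for some $m \in \{1,2\}$ and some integer $d$ with $0 \le d < 2^{m}$; $m$ and $d$ may depend on $i$).
   Context: A walk to infinity on primes in base $b$ is an infinite sequence of primes, starting from an arbitrary prime, in which each term is obtained from the previous one by appending digits (at least one) in base $b$. *)

theory Defs
  imports "HOL-Computational_Algebra.Primes"
begin

text \<open>
  The base-\<open>b\<close> representation of \<open>n\<close>, most significant digit first and without leading
  zeros. The representation of 0 is the empty list; bases below 2 give a junk value.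
\<close>

function digits :: "nat \<Rightarrow> nat \<Rightarrow> nat list" where
  "digits b n = (if b < 2 \<or> n = 0 then [] else digits b (n div b) @ [n mod b])"
  by auto
termination
  by (relation "measure snd") auto

declare digits.simps [simp del]

definition append_right :: "nat \<Rightarrow> nat \<Rightarrow> nat \<Rightarrow> nat \<Rightarrow> bool" where
  "append_right b k p q \<longleftrightarrow>
     (\<exists>ds. 1 \<le> length ds \<and> length ds \<le> k \<and> set ds \<subseteq> {..<b} \<and>
           digits b q = digits b p @ ds)"

text \<open>
  The block of appended digits, and its length between 1 and \<open>k\<close>, may vary from step to step.
\<close>

definition prime_walk_right :: "nat \<Rightarrow> nat \<Rightarrow> (nat \<Rightarrow> nat) \<Rightarrow> bool" where
  "prime_walk_right b k p \<longleftrightarrow>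
     (\<forall>i. prime (p i)) \<and> (\<forall>i. append_right b k (p i) (p (Suc i)))"

lemma digits_less: "d \<in> set (digits b n) \<Longrightarrow> d < b"
proof (induction b n rule: digits.induct)
  case (1 b n)
  then show ?case
    by (subst (asm) (2) digits.simps) (auto split: if_splits)
qed

lemma hd_digits_pos: "b \<ge> 2 \<Longrightarrow> n > 0 \<Longrightarrow> hd (digits b n) > 0"
proof (induction b n rule: digits.induct)
  case (1 b n)
  show ?case
  proof (cases "n div b = 0")
    case True
    then show ?thesis
      using 1 by (subst digits.simps) (auto simp: digits.simps[of b 0] div_eq_0_iff)
  next
    case False
    moreover from this have "digits b (n div b) \<noteq> []"
      using 1 by (subst digits.simps) auto
    ultimately show ?thesis
      using 1 by (subst digits.simps) auto
  qed
qed

lemma horner_sum_digits: "b \<ge> 2 \<Longrightarrow> horner_sum (\<lambda>x. x) b (rev (digits b n)) = n"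
proof (induction b n rule: digits.induct)
  case (1 b n)
  then show ?case
    by (subst digits.simps) auto
qed

lemma digits_snoc:
  assumes "b \<ge> 2" "n > 0" "d < b"
  shows "digits b (b * n + d) = digits b n @ [d]"
  using assms by (subst digits.simps) auto

lemma digits_append:
  assumes "b \<ge> 2" "n > 0" "set ds \<subseteq> {..<b}"
  shows "digits b (b ^ length ds * n + horner_sum (\<lambda>x. x) b (rev ds)) = digits b n @ ds"
  using assms(3)
proof (induction ds rule: rev_induct)
  case (snoc d ds)
  have "digits b (b * (b ^ length ds * n + horner_sum (\<lambda>x. x) b (rev ds)) + d) =
        digits b (b ^ length ds * n + horner_sum (\<lambda>x. x) b (rev ds)) @ [d]"
    using assms snoc.prems by (intro digits_snoc) auto
  then show ?case
    using snoc by (simp add: algebra_simps)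
qed simp

lemma horner_sum_less:
  fixes b :: nat
  assumes "set ds \<subseteq> {..<b}" "b \<ge> 2"
  shows "horner_sum (\<lambda>x. x) b ds < b ^ length ds"
  using assms(1)
proof (induction ds)
  case (Cons d ds)
  then have "d < b" "horner_sum (\<lambda>x. x) b ds + 1 \<le> b ^ length ds" by auto
  then have "d + b * horner_sum (\<lambda>x. x) b ds < b * (horner_sum (\<lambda>x. x) b ds + 1)" by simp
  also have "\<dots> \<le> b * b ^ length ds"
    using \<open>horner_sum (\<lambda>x. x) b ds + 1 \<le> b ^ length ds\<close> by (rule mult_le_mono2)
  finally show ?case by simp
qed simp

lemma digits_block:
  fixes b d m :: nat
  assumes "b \<ge> 2" "d < b ^ m"
  shows "\<exists>ds. length ds = m \<and> set ds \<subseteq> {..<b} \<and> horner_sum (\<lambda>x. x) b (rev ds) = d"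
  using assms(2)
proof (induction m arbitrary: d)
  case (Suc m)
  then have "d div b < b ^ m"
    using assms(1) by (simp add: div_less_iff_less_mult mult.commute)
  then obtain ds where "length ds = m" "set ds \<subseteq> {..<b}" "horner_sum (\<lambda>x. x) b (rev ds) = d div b"
    using Suc.IH by blast
  then show ?case
    using assms(1) by (intro exI[of _ "ds @ [d mod b]"]) auto
qed auto

lemma append_right_iff:
  assumes "b \<ge> 2" "p > 0"
  shows "append_right b k p q \<longleftrightarrow> (\<exists>m d. 1 \<le> m \<and> m \<le> k \<and> d < b ^ m \<and> q = b ^ m * p + d)"
    (is "_ \<longleftrightarrow> ?R")
proof
  assume "append_right b k p q"
  then obtain ds where ds: "1 \<le> length ds" "length ds \<le> k" "set ds \<subseteq> {..<b}"
      "digits b q = digits b p @ ds"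
    unfolding append_right_def by blast
  have "digits b q = digits b (b ^ length ds * p + horner_sum (\<lambda>x. x) b (rev ds))"
    using digits_append[OF assms ds(3)] ds(4) by simp
  then have "q = b ^ length ds * p + horner_sum (\<lambda>x. x) b (rev ds)"
    using horner_sum_digits[OF assms(1)] by metis
  moreover have "horner_sum (\<lambda>x. x) b (rev ds) < b ^ length ds"
    using horner_sum_less[of "rev ds" b] ds(3) assms(1) by simp
  ultimately show ?R
    using ds by blast
next
  assume ?R
  then obtain m d where md: "1 \<le> m" "m \<le> k" "d < b ^ m" "q = b ^ m * p + d"
    by blast
  obtain ds where "length ds = m" "set ds \<subseteq> {..<b}" "horner_sum (\<lambda>x. x) b (rev ds) = d"
    using digits_block[OF assms(1) md(3)] by blast
  then show "append_right b k p q"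
    using digits_append[OF assms, of ds] md unfolding append_right_def by auto
qed

end

theory Submission
  imports Defs "HOL-Number_Theory.Residues"
begin

text \<open>
  Once the terms exceed 3, reduction modulo 3 shows that every step eventually has the form
  \<open>p + 1 \<mapsto> 2 (p + 1)\<close> or \<open>p + 1 \<mapsto> 4 (p + 1)\<close>. By Fermat's little theorem, an odd prime \<open>p\<close>
  divides \<open>2 ^ L * (p + 1) - 1\<close> whenever \<open>p - 1\<close> divides \<open>L\<close>. If all steps are quadruplings, the
  walk itself reaches such a number. If some step is \<open>p + 1 \<mapsto> q + 1 = 2 (p + 1)\<close>, then taking
  \<open>L = (p - 1) (q - 1)\<close> makes both \<open>2 ^ L * (p + 1) - 1\<close> and \<open>2 ^ (L + 1) * (p + 1) - 1\<close>
  composite, and the walk cannot jump over both.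
\<close>

lemma not_prime_power_two_shift:
  fixes p L x :: nat
  assumes p: "prime p" "odd p" and L: "p - 1 dvd L" "L > 0" and x: "x + 1 = 2 ^ L * (p + 1)"
  shows "\<not> prime x"
proof
  assume "prime x"
  have "\<not> p dvd 2"
    using p by (metis dvd_antisym even_numeral primes_dvd_imp_eq two_is_prime_nat)
  then have "[2 ^ (p - 1) = 1] (mod p)"
    using p fermat_theorem by blast
  moreover obtain c where "L = (p - 1) * c"
    using L by blast
  ultimately have "[2 ^ L = 1] (mod p)"
    by (metis cong_pow power_mult power_one)
  then have "[2 ^ L * (p + 1) = 1 * (0 + 1)] (mod p)"
    by (intro cong_mult cong_add) (auto simp: cong_def)
  then have "[x + 1 = 0 + 1] (mod p)"
    using x by simp
  then have "p dvd x"
    by (metis cong_add_rcancel_nat cong_0_iff)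
  then have "p = x"
    using p \<open>prime x\<close> by (simp add: primes_dvd_imp_eq)
  \<comment> \<open>\<open>L > 0\<close> makes \<open>x\<close> strictly larger than
    \<open>p\<close>, so \<open>p\<close> is a proper divisor.\<close>
  have "(2::nat) ^ L \<ge> 2"
    using L by (metis One_nat_def Suc_leI one_le_numeral power_increasing power_one_right)
  then have "2 * (p + 1) \<le> x + 1"
    unfolding x by (rule mult_le_mono1)
  then show False
    using \<open>p = x\<close> by simp
qed

lemma no_prime_walk_doubling_quadrupling:
  fixes x :: "nat \<Rightarrow> nat"
  assumes pr: "\<And>n. prime (x n)" and gt: "\<And>n. x n > 3"
    and step: "\<And>n. x (Suc n) + 1 = 2 * (x n + 1) \<or> x (Suc n) + 1 = 4 * (x n + 1)"
  shows False
proof -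
  have odd: "odd (x n)" for n
    using pr[of n] gt[of n] prime_odd_nat by force
  show False
  proof (cases "\<exists>n. x (Suc n) + 1 = 2 * (x n + 1)")
    case True
    then obtain n where n: "x (Suc n) + 1 = 2 * (x n + 1)" by blast
    define L where "L = (x n - 1) * (x (Suc n) - 1)"
    have reach: "\<exists>m. x m + 1 = 2 ^ k * (x n + 1) \<or> x m + 1 = 2 ^ k * (2 * (x n + 1))" for k
    proof (induction k)
      case 0
      then show ?case by auto
    next
      case (Suc k)
      then obtain m where "x m + 1 = 2 ^ k * (x n + 1) \<or> x m + 1 = 2 ^ k * (2 * (x n + 1))"
        by blast
      \<comment> \<open>From the first alternative, doubling lands on the first for
        \<open>Suc k\<close> and quadrupling on the second; the second alternative for
        \<open>k\<close> is already the first for \<open>Suc k\<close>, with the same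
        \<open>m\<close>.\<close>
      with step[of m] have "x (Suc m) + 1 = 2 ^ Suc k * (x n + 1) \<or>
          x m + 1 = 2 ^ Suc k * (x n + 1) \<or> x (Suc m) + 1 = 2 ^ Suc k * (2 * (x n + 1))"
        by auto
      then show ?case
        by blast
    qed
    obtain m where "x m + 1 = 2 ^ L * (x n + 1) \<or> x m + 1 = 2 ^ L * (x (Suc n) + 1)"
      using reach[of L] unfolding n by blast
    moreover have "L > 0"
      using gt[of n] gt[of "Suc n"] by (simp add: L_def)
    moreover have "x n - 1 dvd L" "x (Suc n) - 1 dvd L"
      by (simp_all add: L_def)
    ultimately show False
      using not_prime_power_two_shift[OF pr odd, of n L "x m"]
        not_prime_power_two_shift[OF pr odd, of "Suc n" L "x m"] pr[of m] by blast
  next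
    case False
    have "x n + 1 = 2 ^ (2 * n) * (x 0 + 1)" for n
    proof (induction n)
      case (Suc n)
      have "x (Suc n) + 1 = 4 * (x n + 1)"
        using False step by blast
      then show ?case
        using Suc by simp
    qed simp
    moreover have "x 0 - 1 > 0"
      using gt[of 0] by simp
    ultimately show False
      \<comment> \<open>The index \<open>x 0 - 1\<close> makes the exponent a multiple of
        \<open>x 0 - 1\<close>, as Fermat requires.\<close>
      using not_prime_power_two_shift[OF pr odd, of 0 "2 * (x 0 - 1)" "x (x 0 - 1)"] pr
      by (metis dvd_triv_right mult_pos_pos zero_less_numeral)
  qed
qed

lemma prime_append_right_two_cases:
  assumes p: "prime p" and q: "prime q" and "append_right 2 2 p q"
  shows "q = 2 * p + 1 \<or> q = 4 * p + 1 \<or> q = 4 * p + 3"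
proof -
  obtain m d where md: "1 \<le> m" "m \<le> 2" "d < 2 ^ m" "q = 2 ^ m * p + d"
    using assms(3) append_right_iff[of 2 p 2 q] prime_gt_0_nat[OF p] by auto
  have "q > 2"
    using md prime_ge_2_nat[OF p] power_increasing[of 1 m "2::nat"] mult_le_mono[of 2 "2 ^ m" 2 p]
    by auto
  then have "odd q"
    using q prime_odd_nat by blast
  moreover have "m = 1 \<or> m = 2"
    using md by auto
  ultimately show ?thesis
    using md by (elim disjE) (auto, presburger+)
qed

text \<open>Modulo 3, residue 2 is sent to 2, 0, 2 by the three maps and residue 1 to 0, 2, 1. As 0
  is excluded, residue 2 is absorbing, and \<open>4 * p + 1\<close> can only lead from 1 to
  2.\<close>

lemma prime_step_mod_3:
  fixes p q :: nat
  assumes "prime p" "p > 3" "prime q" "q > 3" and q: "q = 2 * p + 1 \<or> q = 4 * p + 1 \<or> q = 4 * p + 3"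
  shows "p mod 3 = 2 \<Longrightarrow> q mod 3 = 2 \<and> q \<noteq> 4 * p + 1" and "q \<noteq> 4 * p + 1 \<or> q mod 3 = 2"
proof -
  have *: "\<not> 3 dvd p" "\<not> 3 dvd q"
    using assms(1-4) by (auto simp: prime_nat_iff)
  show "q mod 3 = 2 \<and> q \<noteq> 4 * p + 1" if "p mod 3 = 2"
    using q that *(2) by (elim disjE; presburger)
  show "q \<noteq> 4 * p + 1 \<or> q mod 3 = 2"
    using * by presburger
qed

theorem theorem2p7:
  shows "\<not> (\<exists>p :: nat \<Rightarrow> nat. prime_walk_right 2 2 p)"
proof
  assume "\<exists>p :: nat \<Rightarrow> nat. prime_walk_right 2 2 p"
  then obtain p where pr: "\<And>n. prime (p n)" and "\<And>n. append_right 2 2 (p n) (p (Suc n))"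
    unfolding prime_walk_right_def by blast
  then have step: "p (Suc n) = 2 * p n + 1 \<or> p (Suc n) = 4 * p n + 1 \<or> p (Suc n) = 4 * p n + 3" for n
    using prime_append_right_two_cases by blast
  \<comment> \<open>The walk may start at 2 or 3, so only later terms are known to exceed 3.\<close>
  have gt: "p (Suc n) > 3" for n
    using step[of n] prime_ge_2_nat[OF pr, of n] by linarith
  note mod3 = prime_step_mod_3[OF pr gt pr gt step]
  \<comment> \<open>Once residue 2 occurs, it persists and bars \<open>4 * p + 1\<close>; if it
    never occurs, that step, which would produce it, never happens.\<close>
  have "\<exists>N. \<forall>n\<ge>N. p (Suc (Suc n)) \<noteq> 4 * p (Suc n) + 1"
  proof (cases "\<exists>N. p (Suc N) mod 3 = 2")
    case True
    then obtain N where N: "p (Suc N) mod 3 = 2" by blast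
    have "p (Suc n) mod 3 = 2" if "n \<ge> N" for n
      using that by (induction n rule: dec_induct) (use N mod3(1) in auto)
    then show ?thesis
      using mod3(1) by blast
  next
    case False
    then show ?thesis
      using mod3(2) by blast
  qed
  then obtain N where N: "\<And>n. n \<ge> N \<Longrightarrow> p (Suc (Suc n)) \<noteq> 4 * p (Suc n) + 1" by blast
  show False
  proof (rule no_prime_walk_doubling_quadrupling[of "\<lambda>n. p (Suc (N + n))"])
    show "p (Suc (N + Suc n)) + 1 = 2 * (p (Suc (N + n)) + 1) \<or>
          p (Suc (N + Suc n)) + 1 = 4 * (p (Suc (N + n)) + 1)" for n
      using N[of "N + n"] step[of "Suc (N + n)"] by auto
  qed (use pr gt in auto)
qed

end
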